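(* Let $0<p<1$, let $X$ be a $p$-Banach space with the point separation property, let $I\subset\mathbb{R}$ be an interval, and let $F\colon I\to(X,\|\cdot\|_X^p)$ be a Lipschitz mapping, i.e. there is $L<\infty$ such that $\|F(t)-F(s)\|_X^p\le L|t-s|$ for all $s,t\in I$. Then $F$ is constant on $I$.
   Context: A $p$-norm on a real or complex vector space $X$ is a map $\|\cdot\|_X\colon X\to[0,\infty)$ with $\|x\|_X>0$ for $x\ne0$, $\|\alpha x\|_X=|\alpha|\,\|x\|_X$ for all scalars $\alpha$, and $\|x+y\|_X^p\le\|x\|_X^p+\|y\|_X^p$ for all $x,y\in X$. A $p$-Banach space is a vector space equipped with a $p$-norm for which it is complete; $(x,y)\mapsto\|x-y\|_X^p$ is then a translation-invariant metric. $X$ has the point separation property if for every nonzero $x\in X$ there is a continuous linear functional $x^*\in X^*$ with $x^*(x)\neq0$. *)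

theory Defs
  imports "HOL-Analysis.Analysis"
begin

text \<open>
  The scalar field is any type \<open>'k\<close> of class \<^class>\<open>real_normed_field\<close>. The instances include
  \<^typ>\<open>real\<close> and \<^typ>\<open>complex\<close>; by the Gelfand--Mazur theorem every instance is isometrically
  isomorphic to one of these two, so this is the usual convention of real or complex scalars.
  The space itself is the whole type \<open>'a\<close>.
\<close>

locale p_normed_space = vector_space scale
  for scale :: "'k::real_normed_field \<Rightarrow> 'a::ab_group_add \<Rightarrow> 'a" +
  fixes pnorm :: "'a \<Rightarrow> real" and p :: real
  assumes pnorm_nonneg: "0 \<le> pnorm x"
    and pnorm_pos: "x \<noteq> 0 \<Longrightarrow> 0 < pnorm x"
    and pnorm_scale: "pnorm (scale a x) = norm a * pnorm x"
    and pnorm_triangle: "pnorm (x + y) powr p \<le> pnorm x powr p + pnorm y powr p"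
begin

definition pdist :: "'a \<Rightarrow> 'a \<Rightarrow> real" where
  "pdist x y = pnorm (x - y) powr p"

lemma pnorm_zero [simp]: "pnorm 0 = 0"
  using pnorm_scale[of 0 0] by simp

lemma pnorm_minus: "pnorm (- x) = pnorm x"
  using pnorm_scale[of "- 1" x] by simp

sublocale pmetric: Metric_space UNIV pdist
proof
  fix x y z :: 'a
  show "0 \<le> pdist x y"
    by (simp add: pdist_def)
  show "pdist x y = pdist y x"
    using pnorm_minus[of "x - y"] by (simp add: pdist_def)
  show "pdist x y = 0 \<longleftrightarrow> x = y"
    using pnorm_pos[of "x - y"] by (cases "x = y") (simp_all add: pdist_def)
  show "pdist x z \<le> pdist x y + pdist y z"
    using pnorm_triangle[of "x - y" "y - z"] by (simp add: pdist_def)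
qed

definition dual_space :: "('a \<Rightarrow> 'k) set" where
  "dual_space = {f. Vector_Spaces.linear scale (*) f \<and>
                    continuous_map pmetric.mtopology euclidean f}"

definition point_separation_property :: bool where
  "point_separation_property \<longleftrightarrow> (\<forall>x. x \<noteq> 0 \<longrightarrow> (\<exists>f\<in>dual_space. f x \<noteq> 0))"

end

locale p_Banach_space = p_normed_space +
  assumes complete: "pmetric.mcomplete"

end

theory Submission imports Defs begin

text \<open>
  A continuous functional \<open>f\<close> satisfies \<open>norm (f x) \<le> C * pnorm x\<close>, so \<open>f \<circ> F\<close> is Hoelder
  continuous with exponent \<open>1/p > 1\<close>. Its derivative therefore vanishes, so it is constant, and
  the continuous functionals separate the values of \<open>F\<close>.
\<close>

text \<open>Dividing the bound by \<open>\<bar>t - s\<bar>\<close> leaves the positive power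
  \<open>\<alpha> - 1\<close>, so the difference quotients tend to 0. The derivative within
  \<open>S\<close> vanishes everywhere, and convexity of \<open>S\<close> turns this into
  constancy.\<close>

lemma Hoelder_exponent_gt_1_imp_constant:
  fixes g :: "real \<Rightarrow> 'b::real_normed_vector"
  assumes "convex S" and "1 < \<alpha>"
    and bound: "\<And>s t. s \<in> S \<Longrightarrow> t \<in> S \<Longrightarrow> norm (g t - g s) \<le> K * \<bar>t - s\<bar> powr \<alpha>"
  shows "g constant_on S"
proof -
  have "(g has_derivative (\<lambda>_. 0)) (at s within S)" if s: "s \<in> S" for s
  proof -
    \<comment> \<open>The base tends to 0, where \<open>powr\<close> is continuous because the
      exponent \<open>\<alpha> - 1\<close> is positive.\<close>
    have "((\<lambda>t. K * \<bar>t - s\<bar> powr (\<alpha> - 1)) \<longlongrightarrow> K * 0 powr (\<alpha> - 1)) (at s within S)"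
      using \<open>1 < \<alpha>\<close> by (intro tendsto_intros tendsto_powr') (auto intro!: tendsto_eq_intros)
    then have lim: "((\<lambda>t. K * \<bar>t - s\<bar> powr (\<alpha> - 1)) \<longlongrightarrow> 0) (at s within S)"
      by simp
    \<comment> \<open>The redundant outer norm matches the premise of
      \<open>Lim_null_comparison\<close>.\<close>
    have "norm (norm (g t - g s) / norm (t - s)) \<le> K * \<bar>t - s\<bar> powr (\<alpha> - 1)"
      if "t \<in> S" "t \<noteq> s" for t
      using bound[OF s \<open>t \<in> S\<close>] \<open>t \<noteq> s\<close>
      by (simp add: powr_diff divide_right_mono)
    then have "((\<lambda>t. norm (g t - g s) / norm (t - s)) \<longlongrightarrow> 0) (at s within S)"
      by (intro Lim_null_comparison[OF _ lim]) (auto simp: eventually_at_filter)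
    then show ?thesis
      by (simp add: has_derivative_iff_norm)
  qed
  then show ?thesis
    using has_derivative_zero_constant[OF \<open>convex S\<close>] by (auto simp: constant_on_def)
qed

text \<open>As for normed spaces: continuity at 0 bounds \<open>f\<close> by 1 on a ball, and
  homogeneity carries this bound to all vectors. It turns topological continuity into an estimate in
  \<open>pnorm\<close>.\<close>

lemma (in p_normed_space) dual_space_bounded:
  assumes "f \<in> dual_space" and "0 < p"
  obtains C where "0 < C" and "\<And>x. norm (f x) \<le> C * pnorm x"
proof -
  interpret f: Vector_Spaces.linear scale "(*)" f
    using assms(1) by (simp add: dual_space_def)
  have "openin pmetric.mtopology {x \<in> topspace pmetric.mtopology. f x \<in> ball 0 1}"
    using assms(1) openin_continuous_map_preimage[of pmetric.mtopology euclidean f "ball 0 1"]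
    by (simp add: dual_space_def)
  moreover have "0 \<in> {x \<in> topspace pmetric.mtopology. f x \<in> ball 0 1}"
    by (simp add: f.zero)
  ultimately obtain d where "0 < d"
    and "pmetric.mball 0 d \<subseteq> {x \<in> topspace pmetric.mtopology. f x \<in> ball 0 1}"
    unfolding pmetric.openin_mtopology by blast
  then have d: "norm (f x) < 1" if "pnorm x powr p < d" for x
    using that by (auto simp: pdist_def pnorm_minus subset_iff)
  \<comment> \<open>The metric is a \<open>p\<close>-th power, so a metric radius becomes a
    \<open>pnorm\<close> radius by taking the \<open>p\<close>-th root; halving \<open>d\<close>
    gives the strict inequality \<open>r powr p < d\<close>.\<close>
  define r where "r = (d / 2) powr (1 / p)"
  have "0 < r" and r: "r powr p < d"
    using \<open>0 < d\<close> \<open>0 < p\<close> by (simp_all add: r_def powr_powr)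
  have "norm (f x) \<le> 1 / r * pnorm x" for x
  proof (cases "x = 0")
    case False
    then have "0 < pnorm x"
      by (rule pnorm_pos)
    \<comment> \<open>This scalar brings \<open>x\<close> to \<open>pnorm\<close> exactly
      \<open>r\<close>, hence into the ball where \<open>f\<close> is bounded by 1.\<close>
    define c :: 'k where "c = of_real (r / pnorm x)"
    have "norm (f (scale c x)) < 1"
      using r \<open>0 < r\<close> \<open>0 < pnorm x\<close> by (intro d) (simp add: pnorm_scale c_def norm_divide)
    then show ?thesis
      using \<open>0 < r\<close> \<open>0 < pnorm x\<close>
      by (simp add: f.scale norm_mult c_def norm_divide field_simps)
  qed (simp add: f.zero)
  with \<open>0 < r\<close> that[of "1 / r"] show thesis
    by simp
qed

theorem theorem7p1:
  fixes scale :: "'k::real_normed_field \<Rightarrow> 'a::ab_group_add \<Rightarrow> 'a"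
    and pnorm :: "'a \<Rightarrow> real" and p :: real
    and I :: "real set" and F :: "real \<Rightarrow> 'a"
  assumes "0 < p" and "p < 1"
    and "p_Banach_space scale pnorm p"
    and "p_normed_space.point_separation_property scale pnorm p"
    and "is_interval I"
    and "\<exists>L. \<forall>s\<in>I. \<forall>t\<in>I. pnorm (F t - F s) powr p \<le> L * \<bar>t - s\<bar>"
  shows "F constant_on I"
proof -
  interpret p_Banach_space scale pnorm p
    by fact
  obtain L where L: "\<And>s t. s \<in> I \<Longrightarrow> t \<in> I \<Longrightarrow> pnorm (F t - F s) powr p \<le> L * \<bar>t - s\<bar>"
    using assms(6) by blast
  \<comment> \<open>The \<open>p\<close>-th root of the Lipschitz condition. The sign of
    \<open>L\<close> is unknown; with \<open>\<bar>L\<bar>\<close> both factors are nonnegative and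
    the root splits over the product.\<close>
  have pnorm_F: "pnorm (F t - F s) \<le> \<bar>L\<bar> powr (1 / p) * \<bar>t - s\<bar> powr (1 / p)"
    if "s \<in> I" "t \<in> I" for s t
  proof -
    have "pnorm (F t - F s) = (pnorm (F t - F s) powr p) powr (1 / p)"
      using \<open>0 < p\<close> pnorm_nonneg by (simp add: powr_powr)
    also have "\<dots> \<le> (\<bar>L\<bar> * \<bar>t - s\<bar>) powr (1 / p)"
    proof (rule powr_mono2)
      show "pnorm (F t - F s) powr p \<le> \<bar>L\<bar> * \<bar>t - s\<bar>"
        by (rule order.trans[OF L[OF that]]) (simp add: mult_right_mono)
    qed (use \<open>0 < p\<close> in auto)
    finally show ?thesis
      by (simp add: powr_mult)
  qed
  have const: "(\<lambda>t. f (F t)) constant_on I" if f: "f \<in> dual_space" for f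
  proof -
    interpret f: Vector_Spaces.linear scale "(*)" f
      using f by (simp add: dual_space_def)
    obtain C where "0 < C" and C: "\<And>x. norm (f x) \<le> C * pnorm x"
      using dual_space_bounded[OF f \<open>0 < p\<close>] by blast
    show ?thesis
    proof (rule Hoelder_exponent_gt_1_imp_constant)
      show "convex I"
        using assms(5) by (rule is_interval_convex)
      \<comment> \<open>Here \<open>p < 1\<close> enters: for \<open>p = 1\<close> the exponent
        would be 1, which only says that \<open>f\<close> composed with \<open>F\<close> is
        Lipschitz.\<close>
      show "1 < 1 / p"
        using assms(1,2) by simp
      fix s t assume "s \<in> I" "t \<in> I"
      then have "C * pnorm (F t - F s) \<le> C * (\<bar>L\<bar> powr (1 / p) * \<bar>t - s\<bar> powr (1 / p))"
        using pnorm_F \<open>0 < C\<close> by (intro mult_left_mono) auto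
      with C[of "F t - F s"]
      show "norm (f (F t) - f (F s)) \<le> C * \<bar>L\<bar> powr (1 / p) * \<bar>t - s\<bar> powr (1 / p)"
        by (simp add: f.diff mult.assoc)
    qed
  qed
  have "F t = F s" if "s \<in> I" "t \<in> I" for s t
  proof (rule ccontr)
    assume "F t \<noteq> F s"
    then have "F t - F s \<noteq> 0"
      by simp
    \<comment> \<open>By linearity this \<open>f\<close> takes different values at
      \<open>F t\<close> and \<open>F s\<close>, contrary to \<open>const\<close>.\<close>
    then obtain f where f: "f \<in> dual_space" "f (F t - F s) \<noteq> 0"
      using assms(4) unfolding point_separation_property_def by blast
    interpret f: Vector_Spaces.linear scale "(*)" f
      using f by (simp add: dual_space_def)
    show False
      using f(2) const[OF f(1)] that by (auto simp: constant_on_def f.diff)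
  qed
  then show ?thesis
    unfolding constant_on_def by blast
qed

end
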